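(* Let $\mathcal{A}$ be an $f$-algebra with an identity element $e$, and let $E$ be a vector lattice with the principal projection property. Suppose that $\pi:\mathcal{A}\to\mathcal{L}_{\mathrm{ob}}(E)$ is a positive linear map such that $\pi(e)=I$, the identity operator on $E$. Then $\pi(\mathcal{A})\subseteq\mathrm{Orth}(E)$. If, in addition, $\pi$ preserves the multiplication, then $\pi$ is a unital vector lattice algebra homomorphism from $\mathcal{A}$ into $\mathrm{Orth}(E)$ (that is, a unital algebra homomorphism that is also a vector lattice homomorphism into the vector lattice $\mathrm{Orth}(E)$).
   Context: All vector spaces are real and all vector lattices (in particular those underlying $f$-algebras) are Archimedean. An $f$-algebra is an associative algebra that is a vector lattice in which products of positive elements are positive and in which $x\wedge y=0$ and $z\ge 0$ imply $(xz)\wedge y=(zx)\wedge y=0$. A vector lattice has the principal projection property if every band generated by a single element is a projection band. $\mathcal{L}_{\mathrm{ob}}(E)$ is the ordered vector space of order bounded linear operators on $E$; $\pi$ positive means that $\pi(a)$ is a positive operator whenever $a\ge 0$. $\mathrm{Orth}(E)$ is the vector lattice (and $f$-algebra under composition) of orthomorphisms on $E$, i.e. of order bounded linear operators $T:E\to E$ with $T(B)\subseteq B$ for every band $B$ of $E$. *)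

theory Defs
  imports Complex_Main "HOL-Library.Lattice_Algebras" "HOL-Library.Lub_Glb"
begin

section \<open>Archimedean vector lattices and f-algebras\<close>

text \<open>The absolute value is not extra structure: the superclass
  \<^class>\<open>lattice_ab_group_add_abs\<close> fixes it as the supremum of \<open>x\<close> and \<open>- x\<close>.\<close>

class archimedean_vector_lattice = ordered_real_vector + lattice_ab_group_add_abs +
  assumes archimedean: "(\<And>n::nat. real n *\<^sub>R x \<le> y) \<Longrightarrow> x \<le> 0"

text \<open>Associativity comes from \<^class>\<open>real_algebra\<close>, which does not require an identity element.\<close>

class f_algebra = archimedean_vector_lattice + real_algebra +
  assumes f_mult_nonneg: "0 \<le> x \<Longrightarrow> 0 \<le> y \<Longrightarrow> 0 \<le> x * y"
    and f_disjoint_right: "inf x y = 0 \<Longrightarrow> 0 \<le> z \<Longrightarrow> inf (x * z) y = 0"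
    and f_disjoint_left: "inf x y = 0 \<Longrightarrow> 0 \<le> z \<Longrightarrow> inf (z * x) y = 0"


section \<open>Bands and the principal projection property\<close>

definition order_ideal :: "'e::archimedean_vector_lattice set \<Rightarrow> bool" where
  "order_ideal B \<longleftrightarrow> subspace B \<and> (\<forall>x y. y \<in> B \<and> \<bar>x\<bar> \<le> \<bar>y\<bar> \<longrightarrow> x \<in> B)"

definition band :: "'e::archimedean_vector_lattice set \<Rightarrow> bool" where
  "band B \<longleftrightarrow> order_ideal B \<and> (\<forall>D s. D \<subseteq> B \<and> isLub UNIV D s \<longrightarrow> s \<in> B)"

definition band_generated :: "'e::archimedean_vector_lattice \<Rightarrow> 'e set" where
  "band_generated x = \<Inter> {B. band B \<and> x \<in> B}"

definition disjoint_complement :: "'e::archimedean_vector_lattice set \<Rightarrow> 'e set" where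
  "disjoint_complement B = {y. \<forall>b\<in>B. inf \<bar>y\<bar> \<bar>b\<bar> = 0}"

definition projection_band :: "'e::archimedean_vector_lattice set \<Rightarrow> bool" where
  "projection_band B \<longleftrightarrow> band B \<and> B \<inter> disjoint_complement B = {0} \<and>
    (\<forall>x. \<exists>b\<in>B. \<exists>c\<in>disjoint_complement B. x = b + c)"

text \<open>The property concerns the whole space, that is, the type \<open>'e\<close>.\<close>

definition principal_projection_property :: "'e::archimedean_vector_lattice itself \<Rightarrow> bool" where
  "principal_projection_property _ \<longleftrightarrow> (\<forall>x::'e. projection_band (band_generated x))"


section \<open>Order bounded operators and orthomorphisms\<close>

definition order_bounded_operators :: "('e::archimedean_vector_lattice \<Rightarrow> 'e) set" where
  "order_bounded_operators = {T. linear T \<and> (\<forall>a b. \<exists>c d. T ` {a..b} \<subseteq> {c..d})}"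

text \<open>The operator order, \<open>S \<le> T\<close> iff \<open>T - S\<close> is positive.  It is not the pointwise order
  \<open>(\<le>)\<close> of the function type, which would compare values at all of \<open>'e\<close>.\<close>

definition op_le :: "('e::archimedean_vector_lattice \<Rightarrow> 'e) \<Rightarrow> ('e \<Rightarrow> 'e) \<Rightarrow> bool" where
  "op_le S T \<longleftrightarrow> (\<forall>x\<ge>0. S x \<le> T x)"

definition Orth :: "('e::archimedean_vector_lattice \<Rightarrow> 'e) set" where
  "Orth = {T \<in> order_bounded_operators. \<forall>B. band B \<longrightarrow> T ` B \<subseteq> B}"

text \<open>Binary suprema and infima in the ordered space \<^const>\<open>Orth\<close>; the competing bounds
  range over \<^const>\<open>Orth\<close> only.\<close>

definition is_Orth_sup :: "('e::archimedean_vector_lattice \<Rightarrow> 'e) \<Rightarrow> ('e \<Rightarrow> 'e) \<Rightarrow> ('e \<Rightarrow> 'e) \<Rightarrow> bool" where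
  "is_Orth_sup S T U \<longleftrightarrow> U \<in> Orth \<and> op_le S U \<and> op_le T U \<and>
    (\<forall>V\<in>Orth. op_le S V \<and> op_le T V \<longrightarrow> op_le U V)"

definition is_Orth_inf :: "('e::archimedean_vector_lattice \<Rightarrow> 'e) \<Rightarrow> ('e \<Rightarrow> 'e) \<Rightarrow> ('e \<Rightarrow> 'e) \<Rightarrow> bool" where
  "is_Orth_inf S T U \<longleftrightarrow> U \<in> Orth \<and> op_le U S \<and> op_le U T \<and>
    (\<forall>V\<in>Orth. op_le V S \<and> op_le V T \<longrightarrow> op_le V U)"


section \<open>Maps into the order bounded operators\<close>

text \<open>The function type is not an instance of \<^class>\<open>real_vector\<close>, so linearity is stated for
  the pointwise operations on operators: every evaluation is linear.\<close>

definition operator_linear :: "('a::real_vector \<Rightarrow> 'e::archimedean_vector_lattice \<Rightarrow> 'e) \<Rightarrow> bool" where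
  "operator_linear \<pi> \<longleftrightarrow> (\<forall>x. linear (\<lambda>a. \<pi> a x))"

definition operator_positive :: "('a::f_algebra \<Rightarrow> 'e::archimedean_vector_lattice \<Rightarrow> 'e) \<Rightarrow> bool" where
  "operator_positive \<pi> \<longleftrightarrow> (\<forall>a\<ge>0. \<forall>x\<ge>0. 0 \<le> \<pi> a x)"

definition operator_multiplicative :: "('a::f_algebra \<Rightarrow> 'e::archimedean_vector_lattice \<Rightarrow> 'e) \<Rightarrow> bool" where
  "operator_multiplicative \<pi> \<longleftrightarrow> (\<forall>a b. \<pi> (a * b) = \<pi> a \<circ> \<pi> b)"

text \<open>The first argument is the identity element of the domain.\<close>

definition unital_vector_lattice_algebra_hom_into_Orth ::
    "'a::f_algebra \<Rightarrow> ('a \<Rightarrow> 'e::archimedean_vector_lattice \<Rightarrow> 'e) \<Rightarrow> bool" where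
  "unital_vector_lattice_algebra_hom_into_Orth e \<pi> \<longleftrightarrow>
    range \<pi> \<subseteq> Orth \<and> operator_linear \<pi> \<and> operator_multiplicative \<pi> \<and> \<pi> e = id \<and>
    (\<forall>a b. is_Orth_sup (\<pi> a) (\<pi> b) (\<pi> (sup a b))) \<and>
    (\<forall>a b. is_Orth_inf (\<pi> a) (\<pi> b) (\<pi> (inf a b)))"

end

theory Submission
  imports Defs
begin

text \<open>
  In an \<open>f\<close>-algebra with identity \<open>e\<close>, every \<open>a \<ge> 0\<close> satisfies
  \<open>n (a - n e)\<^sup>+ \<le> a\<^sup>2\<close>, because \<open>(a - n e) (a - n e)\<^sup>+\<close>
  is a square, hence positive, and \<open>a (a - n e)\<^sup>+ \<le> a\<^sup>2\<close>. Hence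
  \<open>a\<close> is the limit, uniformly relative to \<open>a\<^sup>2\<close> and with error at most
  \<open>a\<^sup>2 / n\<close>, of its truncations \<open>a \<and> n e\<close>. Positivity and
  \<open>\<pi>(e) = I\<close> carry this over to operators: for \<open>x \<ge> 0\<close>, the vectors
  \<open>\<pi>(a \<and> n e) x\<close> lie between \<open>0\<close> and \<open>n x\<close> and
  approximate \<open>\<pi>(a) x\<close> from below up to \<open>\<pi>(a\<^sup>2) x / n\<close>. Since
  \<open>E\<close> is Archimedean, \<open>\<pi>(a) x\<close> is their supremum, so it lies in every band
  containing \<open>x\<close>; by the same estimate, \<open>\<pi>(a)\<close> maps \<open>x\<close> to an
  element disjoint from everything that is disjoint from \<open>x\<close>.

  Suppose now that \<open>\<pi>\<close> is multiplicative, and let \<open>T = \<pi>(c\<^sup>+)\<close>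
  and \<open>S = \<pi>(c\<^sup>-)\<close>. Since \<open>c\<^sup>+ c\<^sup>- = 0\<close>, also \<open>T S
  = 0\<close>, so for \<open>x \<ge> 0\<close> the vector \<open>u = T x \<and> S x\<close> is
  annihilated by \<open>T\<close>. But the range of a positive operator that preserves disjointness in
  the above sense is disjoint from its kernel, and therefore \<open>u = 0\<close>. So \<open>T x\<close>
  and \<open>S x\<close> are disjoint with difference \<open>\<pi>(c) x\<close>, which means
  \<open>\<pi>(c\<^sup>+) x = (\<pi>(c) x)\<^sup>+\<close>. As \<open>a \<or> b = b + (a -
  b)\<^sup>+\<close> and \<open>a \<and> b = b - (b - a)\<^sup>+\<close>, the image under
  \<open>\<pi>\<close> of a supremum or infimum is computed pointwise on the positive cone, and such a
  pointwise lattice bound is a lattice bound for the operator order.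
\<close>

section \<open>Disjointness in vector lattices\<close>

lemma pprt_diff_pprt_uminus:
  fixes c :: "'a::lattice_ab_group_add"
  shows "pprt c - pprt (- c) = c"
  using prts[of c] by (simp add: pprt_neg)

lemma inf_pprt_pprt_uminus:
  fixes c :: "'a::lattice_ab_group_add"
  shows "inf (pprt c) (pprt (- c)) = 0"
proof -
  have "pprt (- c) = pprt c + - c"
    using pprt_diff_pprt_uminus[of c] by (simp add: algebra_simps)
  then have "inf (pprt c) (pprt (- c)) = inf (pprt c + 0) (pprt c + - c)"
    by simp
  also have "\<dots> = pprt c + inf (- 0) (- c)"
    by (simp only: add_inf_distrib_left minus_zero)
  also have "\<dots> = pprt c - sup 0 c"
    by (simp only: neg_sup_eq_inf[symmetric] add_uminus_conv_diff)
  also have "\<dots> = 0"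
    by (simp add: pprt_def sup_commute del: diff_sup_eq_inf)
  finally show ?thesis .
qed

lemma inf_add_le_add_inf:
  fixes p q y :: "'a::lattice_ab_group_add"
  assumes "0 \<le> p" "0 \<le> q" "0 \<le> y"
  shows "inf (p + q) y \<le> inf p y + inf q y"
proof -
  have "y \<le> p + y" "y \<le> y + q" "y \<le> y + y"
    using assms by auto
  then have "inf (p + q) y \<le> inf (inf (p + q) (y + q)) (inf (p + y) (y + y))"
    by (meson inf_greatest inf_le1 inf_le2 order_trans)
  also have "\<dots> = inf (inf p y + q) (inf p y + y)"
    by (simp only: add_inf_distrib_right)
  also have "\<dots> = inf p y + inf q y"
    by (simp only: add_inf_distrib_left)
  finally show ?thesis .
qed

lemma inf_scaleR_eq_zero:
  fixes x y :: "'e::archimedean_vector_lattice"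
  assumes "inf x y = 0"
  shows "inf (real n *\<^sub>R x) y = 0"
proof (induction n)
  case 0
  then show ?case
    using assms by (metis inf.absorb1 inf_le2 of_nat_0 scaleR_zero_left)
next
  case (Suc n)
  have nonneg: "0 \<le> x" "0 \<le> y"
    using assms by (metis inf_le1, metis inf_le2)
  then have nx: "0 \<le> real n *\<^sub>R x"
    by (simp add: scaleR_nonneg_nonneg)
  have "inf (real n *\<^sub>R x + x) y \<le> inf (real n *\<^sub>R x) y + inf x y"
    using nonneg nx by (intro inf_add_le_add_inf)
  then have "inf (real n *\<^sub>R x + x) y \<le> 0"
    using Suc assms by simp
  moreover have "0 \<le> inf (real n *\<^sub>R x + x) y"
    using nonneg nx by simp
  ultimately have "inf (real n *\<^sub>R x + x) y = 0"
    by (rule antisym)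
  then show ?case
    by (simp add: scaleR_add_left add.commute)
qed

text \<open>
  The kernel and the range of \<open>T\<close> are disjoint, here for positive elements of both. For
  \<open>u\<close> in the kernel, \<open>T x = T (x - n u) \<le> T (x - n u)\<^sup>+\<close>, and the
  bound is disjoint from \<open>q = (n u - x)\<^sup>+\<close>. So \<open>u \<le> T x\<close> and its
  multiple \<open>n u\<close> are disjoint from \<open>q \<le> n u\<close>, which forces \<open>q =
  0\<close>, that is, \<open>n u \<le> x\<close>; as \<open>n\<close> is arbitrary, \<open>u = 0\<close>.
\<close>

lemma kernel_disjoint_from_range:
  fixes T :: "'e::archimedean_vector_lattice \<Rightarrow> 'e"
  assumes lin: "linear T"
    and pos: "\<And>x. 0 \<le> x \<Longrightarrow> 0 \<le> T x"
    and disj: "\<And>x y. inf x y = 0 \<Longrightarrow> inf (T x) y = 0"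
    and x: "0 \<le> x" and u: "0 \<le> u" "u \<le> T x" "T u = 0"
  shows "u = 0"
proof (rule antisym)
  interpret linear T by fact
  have "real n *\<^sub>R u \<le> x" for n
  proof -
    define p where "p = pprt (x - real n *\<^sub>R u)"
    define q where "q = pprt (real n *\<^sub>R u - x)"
    have "inf p q = 0"
      using inf_pprt_pprt_uminus[of "x - real n *\<^sub>R u"] by (simp add: p_def q_def)
    then have "inf (T p) q = 0"
      by (rule disj)
    have "x - p \<le> real n *\<^sub>R u"
    proof -
      have "x - real n *\<^sub>R u \<le> p" by (simp add: p_def pprt_def)
      then show ?thesis by (simp add: algebra_simps)
    qed
    then have "0 \<le> T (real n *\<^sub>R u - (x - p))"
      by (intro pos) simp
    then have "T x \<le> T p"
      using u by (simp add: diff add scale)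
    then have "u \<le> T p"
      using u by simp
    have "0 \<le> q" by (simp add: q_def)
    have "inf u q \<le> inf (T p) q"
      using \<open>u \<le> T p\<close> by (intro inf_mono) auto
    then have "inf u q = 0"
      using \<open>inf (T p) q = 0\<close> \<open>0 \<le> q\<close> u by (intro antisym) auto
    then have "inf (real n *\<^sub>R u) q = 0"
      by (rule inf_scaleR_eq_zero)
    moreover have "q \<le> real n *\<^sub>R u"
      using x u by (simp add: q_def pprt_def scaleR_nonneg_nonneg)
    ultimately have "q = 0"
      by (simp add: inf_absorb2)
    moreover have "real n *\<^sub>R u - x \<le> q"
      by (simp add: q_def pprt_def)
    ultimately show ?thesis by simp
  qed
  then show "u \<le> 0"
    by (rule archimedean)
qed (fact u)

section \<open>Truncation in unital f-algebras\<close>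

text \<open>
  Multiplying the left factor by \<open>y\<close> keeps it disjoint from \<open>y\<close>, and
  multiplying the right factor by \<open>x\<close> then makes \<open>x y\<close> disjoint from itself.
\<close>

lemma disjoint_mult_eq_zero:
  fixes x y :: "'a::f_algebra"
  assumes "inf x y = 0"
  shows "x * y = 0"
proof -
  have nonneg: "0 \<le> x" "0 \<le> y"
    using assms by (metis inf_le1, metis inf_le2)
  have "inf (x * y) y = 0"
    using assms nonneg by (intro f_disjoint_right)
  then have "inf (x * y) (x * y) = 0"
    using nonneg f_disjoint_left[of y "x * y" x] by (simp add: inf_commute)
  then show ?thesis by simp
qed

lemma mult_pprt_self:
  fixes c :: "'a::f_algebra"
  shows "c * pprt c = pprt c * pprt c"
proof -
  have "inf (pprt (- c)) (pprt c) = 0"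
    by (metis inf_commute inf_pprt_pprt_uminus)
  then have "pprt (- c) * pprt c = 0"
    by (rule disjoint_mult_eq_zero)
  then have "(pprt c - pprt (- c)) * pprt c = pprt c * pprt c"
    by (simp add: left_diff_distrib)
  then show ?thesis
    by (simp only: pprt_diff_pprt_uminus)
qed

lemma square_nonneg:
  fixes c :: "'a::f_algebra"
  shows "0 \<le> c * c"
proof -
  have c: "c = pprt c - pprt (- c)"
    by (simp only: pprt_diff_pprt_uminus)
  have "c * c = c * pprt c - c * pprt (- c)"
    using arg_cong[OF c, of "\<lambda>d. c * d"] by (simp add: right_diff_distrib)
  also have "\<dots> = pprt c * pprt c + pprt (- c) * pprt (- c)"
    using mult_pprt_self[of c] mult_pprt_self[of "- c"] by simp
  finally show ?thesis
    by (simp add: f_mult_nonneg)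
qed

text \<open>
  With \<open>d = (a - n e)\<^sup>+\<close>, the product \<open>(a - n e) d = d\<^sup>2\<close> is
  nonnegative, so \<open>n d \<le> a d\<close>, and \<open>d \<le> a\<close> since \<open>e \<ge>
  0\<close>.
\<close>

lemma truncation_error:
  fixes a e :: "'a::f_algebra"
  assumes "\<And>b. e * b = b" "0 \<le> a"
  shows "real n *\<^sub>R pprt (a - real n *\<^sub>R e) \<le> a * a"
proof -
  define d where "d = pprt (a - real n *\<^sub>R e)"
  have e: "0 \<le> e"
    using square_nonneg[of e] assms(1) by simp
  have d: "0 \<le> d" "d \<le> a"
    using e assms(2) by (auto simp: d_def pprt_def scaleR_nonneg_nonneg)
  have "(a - real n *\<^sub>R e) * d = d * d"
    unfolding d_def by (rule mult_pprt_self)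
  then have "a * d - real n *\<^sub>R d = d * d"
    using assms(1) by (simp add: left_diff_distrib)
  then have "real n *\<^sub>R d \<le> a * d"
    using square_nonneg[of d] by (metis diff_ge_0_iff_ge)
  also have "\<dots> \<le> a * a"
    using f_mult_nonneg[of a "a - d"] assms(2) d by (simp add: right_diff_distrib)
  finally show ?thesis
    by (simp add: d_def)
qed

section \<open>Unital positive maps into the order bounded operators\<close>

locale unital_positive_map =
  fixes e :: "'a::f_algebra"
    and \<pi> :: "'a \<Rightarrow> 'e::archimedean_vector_lattice \<Rightarrow> 'e"
  assumes identity: "e * a = a"
    and order_bounded: "\<pi> a \<in> order_bounded_operators"
    and map_linear: "linear (\<lambda>a. \<pi> a x)"
    and positive: "0 \<le> a \<Longrightarrow> 0 \<le> x \<Longrightarrow> 0 \<le> \<pi> a x"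
    and map_unit: "\<pi> e x = x"
begin

lemma operator_is_linear: "linear (\<pi> a)"
  using order_bounded[of a] by (simp add: order_bounded_operators_def)

lemmas map_diff = linear_diff[OF map_linear]
  and map_scaleR = linear_scale[OF map_linear]
  and map_add = linear_add[OF map_linear]

lemma map_mono: "a \<le> b \<Longrightarrow> 0 \<le> x \<Longrightarrow> \<pi> a x \<le> \<pi> b x"
  using positive[of "b - a" x] by (simp add: map_diff)

text \<open>
  The image of \<open>a \<and> n e = a - (a - n e)\<^sup>+\<close>, the part of \<open>\<pi>(a) x\<close>
  that is controlled by \<open>x\<close>.
\<close>

definition truncated :: "nat \<Rightarrow> 'a \<Rightarrow> 'e \<Rightarrow> 'e" where
  "truncated n a x = \<pi> (a - pprt (a - real n *\<^sub>R e)) x"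

lemma truncated_nonneg:
  assumes "0 \<le> a" "0 \<le> x"
  shows "0 \<le> truncated n a x"
proof -
  have "0 \<le> e"
    using square_nonneg[of e] identity by simp
  then have "pprt (a - real n *\<^sub>R e) \<le> a"
    using assms by (simp add: pprt_def scaleR_nonneg_nonneg)
  then show ?thesis
    using assms by (simp add: truncated_def positive)
qed

lemma truncated_le_scaleR:
  assumes "0 \<le> x"
  shows "truncated n a x \<le> real n *\<^sub>R x"
proof -
  have "a - real n *\<^sub>R e \<le> pprt (a - real n *\<^sub>R e)"
    by (simp add: pprt_def)
  then have "a - pprt (a - real n *\<^sub>R e) \<le> real n *\<^sub>R e"
    by (simp add: algebra_simps)
  then have "truncated n a x \<le> \<pi> (real n *\<^sub>R e) x"
    unfolding truncated_def using assms by (rule map_mono)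
  then show ?thesis
    by (simp add: map_scaleR map_unit)
qed

lemma truncated_le:
  assumes "0 \<le> x"
  shows "truncated n a x \<le> \<pi> a x"
  unfolding truncated_def using assms by (intro map_mono) simp_all

lemma truncated_error:
  assumes "0 \<le> a" "0 \<le> x"
  shows "real n *\<^sub>R (\<pi> a x - truncated n a x) \<le> \<pi> (a * a) x"
proof -
  have "\<pi> (real n *\<^sub>R pprt (a - real n *\<^sub>R e)) x \<le> \<pi> (a * a) x"
    using assms identity by (intro map_mono truncation_error)
  then show ?thesis
    by (simp add: truncated_def map_diff map_scaleR)
qed

text \<open>
  The truncations lie below multiples of \<open>x\<close> and so stay disjoint from \<open>y\<close>.
  Only the remainder can meet \<open>y\<close>, and it is at most \<open>\<pi>(a\<^sup>2) x / n\<close>.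
\<close>

lemma positive_preserves_disjointness:
  assumes a: "0 \<le> a" and xy: "inf x y = 0"
  shows "inf (\<pi> a x) y = 0"
proof (rule antisym)
  have x: "0 \<le> x" and y: "0 \<le> y"
    using xy by (metis inf_le1, metis inf_le2)
  show "0 \<le> inf (\<pi> a x) y"
    using a x y by (simp add: positive)
  have "real n *\<^sub>R inf (\<pi> a x) y \<le> \<pi> (a * a) x" for n
  proof -
    define r where "r = \<pi> a x - truncated n a x"
    have t: "0 \<le> truncated n a x" and r: "0 \<le> r"
      using truncated_nonneg[OF a x] truncated_le[OF x] by (auto simp: r_def)
    have "inf (truncated n a x) y \<le> inf (real n *\<^sub>R x) y"
      using truncated_le_scaleR[OF x] by (intro inf_mono) auto
    then have "inf (truncated n a x) y \<le> 0"
      using inf_scaleR_eq_zero[OF xy] by simp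
    moreover have "inf (truncated n a x + r) y \<le> inf (truncated n a x) y + inf r y"
      using t r y by (rule inf_add_le_add_inf)
    moreover have "inf r y \<le> r" by simp
    ultimately have "inf (truncated n a x + r) y \<le> 0 + r"
      by (meson add_mono order_trans)
    then have "inf (\<pi> a x) y \<le> r"
      by (simp add: r_def)
    then have "real n *\<^sub>R inf (\<pi> a x) y \<le> real n *\<^sub>R r"
      by (rule scaleR_left_mono) simp
    also have "\<dots> \<le> \<pi> (a * a) x"
      unfolding r_def using a x by (rule truncated_error)
    finally show ?thesis .
  qed
  then show "inf (\<pi> a x) y \<le> 0"
    by (rule archimedean)
qed

text \<open>
  An upper bound \<open>s\<close> of all truncations satisfies \<open>n (\<pi>(a) x - s) \<le>
  \<pi>(a\<^sup>2) x\<close> for every \<open>n\<close>, so that the Archimedean property gives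
  \<open>\<pi>(a) x \<le> s\<close>.
\<close>

lemma isLub_truncated:
  assumes a: "0 \<le> a" and x: "0 \<le> x"
  shows "isLub UNIV (range (\<lambda>n. truncated n a x)) (\<pi> a x)"
proof (rule isLubI2)
  show "isUb UNIV (range (\<lambda>n. truncated n a x)) (\<pi> a x)"
    using truncated_le[OF x] by (auto intro!: isUbI setleI)
  show "\<pi> a x <=* Collect (isUb UNIV (range (\<lambda>n. truncated n a x)))"
  proof (rule setgeI, clarify)
    fix s assume "isUb UNIV (range (\<lambda>n. truncated n a x)) s"
    then have s: "truncated n a x \<le> s" for n
      by (auto simp: isUb_def setle_def)
    have "real n *\<^sub>R (\<pi> a x - s) \<le> \<pi> (a * a) x" for n
    proof -
      have "real n *\<^sub>R (\<pi> a x - s) \<le> real n *\<^sub>R (\<pi> a x - truncated n a x)"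
        using s[of n] by (intro scaleR_left_mono) auto
      also have "\<dots> \<le> \<pi> (a * a) x"
        using a x by (rule truncated_error)
      finally show ?thesis .
    qed
    then have "\<pi> a x - s \<le> 0"
      by (rule archimedean)
    then show "\<pi> a x \<le> s" by simp
  qed
qed

lemma positive_image_in_band:
  assumes B: "band B" and a: "0 \<le> a" and x: "0 \<le> x" "x \<in> B"
  shows "\<pi> a x \<in> B"
proof -
  have sub: "subspace B" and solid: "\<And>z y. y \<in> B \<Longrightarrow> \<bar>z\<bar> \<le> \<bar>y\<bar> \<Longrightarrow> z \<in> B"
    using B by (auto simp: band_def order_ideal_def)
  have "truncated n a x \<in> B" for n
  proof (rule solid)
    show "real n *\<^sub>R x \<in> B"
      using sub x by (simp add: subspace_scale)
    show "\<bar>truncated n a x\<bar> \<le> \<bar>real n *\<^sub>R x\<bar>"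
      using truncated_nonneg[OF a x(1)] truncated_le_scaleR[OF x(1)] x(1)
      by (simp add: scaleR_nonneg_nonneg)
  qed
  then have "range (\<lambda>n. truncated n a x) \<subseteq> B"
    by blast
  then show ?thesis
    using B isLub_truncated[OF a x(1)] unfolding band_def by metis
qed

lemma preserves_bands:
  assumes B: "band B" and x: "x \<in> B"
  shows "\<pi> a x \<in> B"
proof -
  have sub: "subspace B" and solid: "\<And>z y. y \<in> B \<Longrightarrow> \<bar>z\<bar> \<le> \<bar>y\<bar> \<Longrightarrow> z \<in> B"
    using B by (auto simp: band_def order_ideal_def)
  have pprt_in: "pprt y \<in> B" if "y \<in> B" for y
  proof (rule solid[OF that])
    show "\<bar>pprt y\<bar> \<le> \<bar>y\<bar>"
      using abs_ge_self[of y] abs_ge_zero[of y] by (simp add: pprt_def)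
  qed
  have nonneg: "\<pi> b x \<in> B" if b: "0 \<le> b" for b
  proof -
    have "- x \<in> B"
      using sub x by (simp add: subspace_neg)
    then have "\<pi> b (pprt x) - \<pi> b (pprt (- x)) \<in> B"
      using sub x b by (intro subspace_diff positive_image_in_band[OF B] pprt_in) auto
    then have "\<pi> b (pprt x - pprt (- x)) \<in> B"
      by (simp add: linear_diff[OF operator_is_linear])
    then show ?thesis
      by (simp only: pprt_diff_pprt_uminus)
  qed
  then have "\<pi> (pprt a) x - \<pi> (pprt (- a)) x \<in> B"
    using sub by (intro subspace_diff) auto
  then have "\<pi> (pprt a - pprt (- a)) x \<in> B"
    by (simp add: map_diff)
  then show ?thesis
    by (simp only: pprt_diff_pprt_uminus)
qed

lemma in_Orth: "\<pi> a \<in> Orth"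
  using order_bounded preserves_bands by (auto simp: Orth_def)

end

section \<open>Multiplicative maps preserve the lattice operations\<close>

locale unital_positive_representation = unital_positive_map +
  assumes multiplicative: "\<pi> (a * b) x = \<pi> a (\<pi> b x)"
begin

text \<open>
  The meet \<open>u\<close> is annihilated by \<open>\<pi>(a)\<close>, because \<open>0 \<le> u \<le>
  \<pi>(b) x\<close> and \<open>a b = 0\<close>; it also lies below an element of the range of
  \<open>\<pi>(a)\<close>.
\<close>

lemma disjoint_images:
  assumes ab: "inf a b = 0" and x: "0 \<le> x"
  shows "inf (\<pi> a x) (\<pi> b x) = 0"
proof -
  define u where "u = inf (\<pi> a x) (\<pi> b x)"
  have a: "0 \<le> a" and b: "0 \<le> b"
    using ab by (metis inf_le1, metis inf_le2)
  have u: "0 \<le> u" "u \<le> \<pi> a x" "u \<le> \<pi> b x"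
    using a b x by (auto simp: u_def positive)
  have "\<pi> a (\<pi> b x) = 0"
    using multiplicative[of a b x] disjoint_mult_eq_zero[OF ab] linear_0[OF map_linear] by simp
  moreover have "0 \<le> \<pi> a (\<pi> b x - u)"
    using a u by (intro positive) auto
  ultimately have "\<pi> a u \<le> 0"
    by (simp add: linear_diff[OF operator_is_linear])
  then have "\<pi> a u = 0"
    using positive[OF a u(1)] by (intro antisym)
  then have "u = 0"
    using kernel_disjoint_from_range[OF operator_is_linear, of a x u]
      positive[OF a] positive_preserves_disjointness[OF a] x u by blast
  then show ?thesis
    by (simp add: u_def)
qed

text \<open>
  Any \<open>w \<ge> \<pi>(c\<^sup>+) x - \<pi>(c\<^sup>-) x\<close> with \<open>w \<ge> 0\<close>
  exceeds \<open>\<pi>(c\<^sup>+) x\<close>, since the two terms of the difference are disjoint.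
\<close>

lemma map_pprt_least:
  assumes x: "0 \<le> x" and w: "0 \<le> w" "\<pi> c x \<le> w"
  shows "\<pi> (pprt c) x \<le> w"
proof -
  define p where "p = \<pi> (pprt c) x"
  define q where "q = \<pi> (pprt (- c)) x"
  have "inf p q = 0"
    unfolding p_def q_def using inf_pprt_pprt_uminus x by (rule disjoint_images)
  have c: "c = pprt c - pprt (- c)"
    by (simp only: pprt_diff_pprt_uminus)
  have "\<pi> c x = p - q"
    using arg_cong[OF c, of "\<lambda>d. \<pi> d x"] by (simp add: p_def q_def map_diff)
  then have "p - q \<le> w"
    using w by simp
  then have "p \<le> w + q"
    by (simp only: diff_le_eq)
  moreover have "p \<le> w + p"
    using w by simp
  ultimately have "p \<le> inf (w + p) (w + q)"
    by simp
  also have "\<dots> = w + inf p q"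
    by (simp add: add_inf_distrib_left)
  finally show ?thesis
    using \<open>inf p q = 0\<close> by (simp add: p_def)
qed

text \<open>
  Taking \<open>w = V x - \<pi>(b) x\<close>, for an upper bound \<open>V\<close> of
  \<open>\<pi>(a)\<close> and \<open>\<pi>(b)\<close>, reduces the claim to \<open>(a -
  b)\<^sup>+\<close>.
\<close>

lemma is_Orth_sup_map: "is_Orth_sup (\<pi> a) (\<pi> b) (\<pi> (sup a b))"
proof -
  have sup: "sup a b = b + pprt (a - b)"
    by (simp add: pprt_def add_sup_distrib_left)
  have "\<pi> (sup a b) x \<le> V x"
    if V: "op_le (\<pi> a) V" "op_le (\<pi> b) V" and x: "0 \<le> x" for V x
  proof -
    have "\<pi> (pprt (a - b)) x \<le> V x - \<pi> b x"
      using V x by (intro map_pprt_least) (auto simp: op_le_def map_diff)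
    then show ?thesis
      by (simp add: sup map_add algebra_simps)
  qed
  then show ?thesis
    using in_Orth by (auto simp: is_Orth_sup_def op_le_def intro!: map_mono)
qed

lemma is_Orth_inf_map: "is_Orth_inf (\<pi> a) (\<pi> b) (\<pi> (inf a b))"
proof -
  have inf: "inf a b = b - pprt (b - a)"
    by (simp add: pprt_def add_inf_distrib_left inf_commute)
  have "V x \<le> \<pi> (inf a b) x"
    if V: "op_le V (\<pi> a)" "op_le V (\<pi> b)" and x: "0 \<le> x" for V x
  proof -
    have "\<pi> (pprt (b - a)) x \<le> \<pi> b x - V x"
      using V x by (intro map_pprt_least) (auto simp: op_le_def map_diff)
    then show ?thesis
      by (simp add: inf map_diff algebra_simps)
  qed
  then show ?thesis
    using in_Orth by (auto simp: is_Orth_inf_def op_le_def intro!: map_mono)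
qed

end

section \<open>The homomorphism into the orthomorphisms\<close>

theorem proposition2p6:
  fixes e :: "'a::f_algebra"
    and \<pi> :: "'a \<Rightarrow> 'e::archimedean_vector_lattice \<Rightarrow> 'e"
  assumes identity: "\<And>a. e * a = a" "\<And>a. a * e = a"
    and ppp: "principal_projection_property TYPE('e)"
    and order_bounded: "range \<pi> \<subseteq> order_bounded_operators"
    and linear: "operator_linear \<pi>"
    and positive: "operator_positive \<pi>"
    and unital: "\<pi> e = id"
  shows "range \<pi> \<subseteq> Orth \<and>
    (operator_multiplicative \<pi> \<longrightarrow> unital_vector_lattice_algebra_hom_into_Orth e \<pi>)"
proof (intro conjI impI)
  interpret unital_positive_map e \<pi>
    using identity(1) order_bounded linear positive unital
    by (intro unital_positive_map.intro) (auto simp: operator_linear_def operator_positive_def)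
  show range: "range \<pi> \<subseteq> Orth"
    using in_Orth by blast
  assume mult: "operator_multiplicative \<pi>"
  interpret unital_positive_representation e \<pi>
    using mult by unfold_locales (simp add: operator_multiplicative_def)
  show "unital_vector_lattice_algebra_hom_into_Orth e \<pi>"
    using range linear mult unital is_Orth_sup_map is_Orth_inf_map
    by (simp add: unital_vector_lattice_algebra_hom_into_Orth_def)
qed

end
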